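(* Let $n$ be a positive odd integer and let $\mathbb{T}^n = (S^1)^n$ be the $n$-dimensional torus, a topological group under coordinatewise multiplication with the product topology. Then there exist no continuous inverse ambiguous functions $f : \mathbb{T}^n \to \mathbb{T}^n$.
   Context: For a group $G$, a function $f : G \to G$ is called inverse ambiguous if it is bijective and its inverse function satisfies $f^{-1}(x) = (f(x))^{-1}$ for all $x \in G$, where the right-hand side is the group inverse of $f(x)$. Equivalently, $f(f(x)) = x^{-1}$ for all $x \in G$. Here $S^1 = \{z \in \mathbb{C} : |z| = 1\}$ is the circle group under multiplication. *)

theory Defs
  imports "HOL-Analysis.Analysis" "HOL-Algebra.Group"
begin

definition inverse_ambiguous :: "('a, 'b) monoid_scheme \<Rightarrow> ('a \<Rightarrow> 'a) \<Rightarrow> bool" where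
  "inverse_ambiguous G f \<longleftrightarrow>
     bij_betw f (carrier G) (carrier G) \<and>
     (\<forall>x\<in>carrier G. inv_into (carrier G) f x = inv\<^bsub>G\<^esub> (f x))"

definition circle_group :: "complex monoid" where
  "circle_group = \<lparr>carrier = {z. norm z = 1}, monoid.mult = (*), one = 1\<rparr>"

(* The torus of dimension CARD('n), a nonempty finite index type.  The topology of the
   ambient type complex ^ 'n is the product topology (open_vec_def), so the subspace
   topology on the carrier is the product topology of the circles. *)
definition torus_group :: "(complex ^ 'n::finite) monoid" where
  "torus_group = \<lparr>carrier = {z. \<forall>i. z $ i \<in> carrier circle_group},
     monoid.mult = (\<lambda>z w. \<chi> i. z $ i \<otimes>\<^bsub>circle_group\<^esub> w $ i),
     one = (\<chi> i. \<one>\<^bsub>circle_group\<^esub>)\<rparr>"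

lemma group_circle_group: "group circle_group"
proof (rule groupI)
  fix x assume "x \<in> carrier circle_group"
  then show "\<exists>y\<in>carrier circle_group. y \<otimes>\<^bsub>circle_group\<^esub> x = \<one>\<^bsub>circle_group\<^esub>"
    by (intro bexI[of _ "inverse x"]) (auto simp: circle_group_def norm_inverse intro!: left_inverse)
qed (auto simp: circle_group_def norm_mult)

lemma group_torus_group: "group (torus_group :: (complex ^ 'n::finite) monoid)"
proof (rule groupI)
  interpret C: group circle_group by (rule group_circle_group)
  fix x :: "complex ^ 'n" assume "x \<in> carrier torus_group"
  then show "\<exists>y\<in>carrier torus_group. y \<otimes>\<^bsub>torus_group\<^esub> x = \<one>\<^bsub>torus_group\<^esub>"
    by (intro bexI[of _ "\<chi> i. inv\<^bsub>circle_group\<^esub> (x $ i)"])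
       (auto simp: torus_group_def vec_eq_iff)
qed (use group_circle_group in \<open>auto simp: torus_group_def vec_eq_iff group.is_monoid
       monoid.m_closed monoid.one_closed monoid.m_assoc monoid.l_one\<close>)

end

theory Submission imports Defs begin

text \<open>
  Lifting \<open>f\<close> through the covering \<open>\<real>\<^sup>n \<rightarrow> \<T>\<^sup>n\<close> yields a continuous \<open>g\<close>, and since
  \<open>g (t + m) - g t\<close> lies in \<open>\<int>\<^sup>n\<close> for \<open>m \<in> \<int>\<^sup>n\<close>, it equals \<open>A m\<close> for a matrix \<open>A\<close> independent
  of \<open>t\<close> (the action of \<open>f\<close> on \<open>\<pi>\<^sub>1\<close>). The map \<open>t \<mapsto> g (g t) + t\<close> is continuous with values in
  \<open>\<int>\<^sup>n\<close>, hence constant, so \<open>A\<^sup>2 = -I\<close> and \<open>(det A)\<^sup>2 = (-1)\<^sup>n\<close>, which is impossible for odd \<open>n\<close>.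
\<close>

definition int_lattice :: "(real ^ 'n) set" where
  "int_lattice = {m. \<forall>i. m $ i \<in> \<int>}"

definition torus_exp :: "real ^ 'n \<Rightarrow> complex ^ 'n::finite" where
  "torus_exp t = (\<chi> i. cis (2 * pi * t $ i))"

lemma int_lattice_add: "m \<in> int_lattice \<Longrightarrow> m' \<in> int_lattice \<Longrightarrow> m + m' \<in> int_lattice"
  by (simp add: int_lattice_def)

lemma axis_in_int_lattice: "axis i 1 \<in> int_lattice"
  by (simp add: int_lattice_def axis_def)

lemma of_int_axis_in_int_lattice: "of_int k *s axis i 1 \<in> int_lattice"
  by (simp add: int_lattice_def axis_def)

text \<open>Distinct integers are at least 1 apart, so each coordinate of \<open>h\<close> is a
  continuous function with discrete range on a connected set.\<close>

lemma continuous_int_lattice_constant: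
  fixes h :: "'a::topological_space \<Rightarrow> real ^ 'n"
  assumes "connected S" "continuous_on S h" "h ` S \<subseteq> int_lattice" "x \<in> S" "y \<in> S"
  shows "h x = h y"
proof -
  have "(\<lambda>t. h t $ i) constant_on S" for i
  proof (rule continuous_discrete_range_constant[OF assms(1)])
    show "continuous_on S (\<lambda>t. h t $ i)"
      using assms(2) by (intro continuous_intros)
    fix s assume s: "s \<in> S"
    have "1 \<le> norm (h t $ i - h s $ i)" if "t \<in> S" "h t $ i \<noteq> h s $ i" for t
    proof -
      have "h t $ i - h s $ i \<in> \<int>"
        using assms(3) s that(1) by (auto simp: int_lattice_def image_subset_iff)
      then show ?thesis
        using Ints_nonzero_abs_ge1[of "h t $ i - h s $ i"] that(2) by simp
    qed
    then show "\<exists>e>0. \<forall>t. t \<in> S \<and> h t $ i \<noteq> h s $ i \<longrightarrow> e \<le> norm (h t $ i - h s $ i)"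
      by (intro exI[of _ 1]) auto
  qed
  then show ?thesis
    using assms(4,5) unfolding constant_on_def vec_eq_iff by metis
qed

text \<open>\<open>matrix D\<close> records only the values of \<open>D\<close> at the unit vectors,
  and \<open>D\<close> need not be linear off the lattice. Additivity carries these values to
  integer multiples, by induction from 0 in both directions, and then to sums over the
  coordinates.\<close>

lemma additive_on_int_lattice_matrix:
  fixes D :: "real ^ 'n::finite \<Rightarrow> real ^ 'm::finite"
  assumes add: "\<And>m m'. m \<in> int_lattice \<Longrightarrow> m' \<in> int_lattice \<Longrightarrow> D (m + m') = D m + D m'"
    and m: "m \<in> int_lattice"
  shows "D m = matrix D *v m"
proof -
  have zero_in: "(0 :: real ^ 'n) \<in> int_lattice"
    by (simp add: int_lattice_def)
  have D0: "D 0 = 0"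
    using add[OF zero_in zero_in] by simp
  have step: "D (of_int (k + 1) *s axis i 1) = D (of_int k *s axis i 1) + D (axis i 1)" for k i
    using add[OF of_int_axis_in_int_lattice axis_in_int_lattice, of k i i]
    by (simp add: vector_sadd_rdistrib)
  have scale: "D (of_int k *s axis i 1) = of_int k *s D (axis i 1)" for k i
  proof (induction k rule: int_induct[where k = 0])
    case base
    show ?case by (simp add: D0)
  next
    case (step1 k)
    then show ?case
      using step[of k i] by (simp add: vector_sadd_rdistrib)
  next
    case (step2 k)
    then show ?case
      using step[of "k - 1" i] by (simp add: vec_eq_iff algebra_simps)
  qed
  have coord: "D (m $ i *s axis i 1) = m $ i *s D (axis i 1)" for i
    using m scale by (auto simp: int_lattice_def elim!: Ints_cases dest!: spec[of _ i])
  \<comment> \<open>Membership of the partial sums is carried along because additivity is assumed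
    only for lattice vectors.\<close>
  have "(\<Sum>i\<in>S. m $ i *s axis i 1) \<in> int_lattice \<and>
      D (\<Sum>i\<in>S. m $ i *s axis i 1) = (\<Sum>i\<in>S. m $ i *s D (axis i 1))" for S
  proof (induction S rule: infinite_finite_induct)
    case (insert i S)
    have "m $ i *s axis i 1 \<in> int_lattice"
      using m by (auto simp: int_lattice_def axis_def)
    then show ?case
      using insert by (simp add: add coord int_lattice_add)
  qed (simp_all add: D0 zero_in)
  from this[of UNIV] have "D m = (\<Sum>i\<in>UNIV. m $ i *s D (axis i 1))"
    by (simp add: basis_expansion)
  also have "\<dots> = matrix D *v m"
    by (simp add: matrix_mult_sum column_def matrix_def)
  finally show ?thesis .
qed

text \<open>Taking determinants gives \<open>det A * det A = (-1) ^ CARD('n)\<close>; in odd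
  dimension this would be a negative real square.\<close>

lemma square_eq_neg_one_imp_even:
  fixes A :: "real ^ 'n ^ 'n::finite"
  assumes "A ** A = - mat 1"
  shows "even CARD('n)"
proof (rule ccontr)
  assume odd: "odd CARD('n)"
  \<comment> \<open>Written as a scaling of rows, so that \<open>det_rows_mul\<close> extracts one
    factor -1 per row.\<close>
  have "- mat 1 = (\<chi> i. (-1) *s ((mat 1 :: real ^ 'n ^ 'n) $ i))"
    by (simp add: vec_eq_iff)
  then have "det (- mat 1 :: real ^ 'n ^ 'n) = (-1) ^ CARD('n)"
    by (simp only: det_rows_mul) simp
  then have "det A * det A = -1"
    using assms odd by (metis det_mul power_minus_odd power_one)
  then show False
    by (metis not_square_less_zero neg_less_0_iff_less zero_less_one)
qed

lemma torus_exp_in_torus: "torus_exp t \<in> carrier torus_group"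
  by (simp add: torus_exp_def torus_group_def circle_group_def)

lemma continuous_on_torus_exp: "continuous_on S torus_exp"
  unfolding torus_exp_def by (intro continuous_intros)

text \<open>The factor \<open>2 * pi\<close> gives each coordinate period 1, since
  \<open>exp z = 1\<close> exactly on the integer multiples of 2 pi i. Hence the fibres of the
  covering are the cosets of the lattice.\<close>

lemma torus_exp_eq_iff: "torus_exp s = torus_exp t \<longleftrightarrow> s - t \<in> int_lattice"
proof -
  have "cis (2 * pi * a) = cis (2 * pi * b) \<longleftrightarrow> a - b \<in> \<int>" for a b :: real
  proof -
    have "cis (2 * pi * a) = cis (2 * pi * b) \<longleftrightarrow> cis (2 * pi * (a - b)) = 1"
      by (simp add: right_diff_distrib flip: cis_divide)
    also have "\<dots> \<longleftrightarrow> (\<exists>k::int. 2 * pi * (a - b) = of_int (2 * k) * pi)"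
      by (simp add: cis_conv_exp exp_eq_1)
    also have "\<dots> \<longleftrightarrow> (\<exists>k::int. a - b = of_int k)"
    proof -
      have "2 * pi * (a - b) = of_int (2 * k) * pi \<longleftrightarrow> a - b = of_int k" for k
        by simp
      then show ?thesis
        by blast
    qed
    finally show ?thesis
      by (auto simp: Ints_def)
  qed
  then show ?thesis
    by (simp add: torus_exp_def vec_eq_iff int_lattice_def)
qed

text \<open>Each coordinate of \<open>F\<close> is nowhere zero, so it has a continuous logarithm on
  the contractible set \<open>S\<close>. Modulus 1 makes the logarithm purely imaginary, and its
  imaginary part divided by \<open>2 * pi\<close> is the lift.\<close>

lemma torus_map_lift:
  fixes F :: "'a::real_normed_vector \<Rightarrow> complex ^ 'n::finite"
  assumes "continuous_on S F" "contractible S" "F ` S \<subseteq> carrier torus_group"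
  obtains g where "continuous_on S g" "\<And>t. t \<in> S \<Longrightarrow> F t = torus_exp (g t)"
proof -
  have norm1: "norm (F t $ i) = 1" if "t \<in> S" for t i
    using assms(3) that by (auto simp: torus_group_def circle_group_def image_subset_iff)
  have "\<exists>l. continuous_on S l \<and> (\<forall>t\<in>S. F t $ i = exp (l t))" for i
  proof -
    have "continuous_on S (\<lambda>t. F t $ i)"
      using assms(1) by (intro continuous_intros)
    moreover have "F t $ i \<noteq> 0" if "t \<in> S" for t
      using norm1[OF that, of i] by auto
    ultimately obtain l where "continuous_on S l" "\<And>t. t \<in> S \<Longrightarrow> F t $ i = exp (l t)"
      using continuous_logarithm_on_contractible[OF _ assms(2)] by blast
    then show ?thesis
      by blast
  qed
  then obtain l where contl: "\<And>i. continuous_on S (l i)"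
    and l: "\<And>i t. t \<in> S \<Longrightarrow> F t $ i = exp (l i t)"
    by metis
  show thesis
  proof
    show "continuous_on S (\<lambda>t. \<chi> i. Im (l i t) / (2 * pi))"
      using contl by (intro continuous_intros) auto
    fix t assume t: "t \<in> S"
    have "exp (l i t) = cis (Im (l i t))" for i
      using norm1[OF t, of i] l[OF t, of i] by (simp add: exp_eq_polar norm_mult)
    then show "F t = torus_exp (\<chi> i. Im (l i t) / (2 * pi))"
      by (simp add: torus_exp_def vec_eq_iff l[OF t])
  qed
qed

lemma inverse_ambiguous_closed:
  "inverse_ambiguous G f \<Longrightarrow> x \<in> carrier G \<Longrightarrow> f x \<in> carrier G"
  by (auto simp: inverse_ambiguous_def bij_betw_def)

text \<open>Apply the defining identity at the point \<open>f x\<close>, whose preimage is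
  \<open>x\<close>. The product form contains no group inverse, so in the torus it unfolds to
  coordinatewise multiplication.\<close>

lemma (in group) inverse_ambiguous_mult:
  assumes "inverse_ambiguous G f" "x \<in> carrier G"
  shows "f (f x) \<otimes> x = \<one>"
proof -
  have "inv (f (f x)) = x"
    using assms by (metis bij_betw_inv_into_left inverse_ambiguous_closed inverse_ambiguous_def)
  then show ?thesis
    using assms by (metis inverse_ambiguous_closed r_inv)
qed

theorem theorem2p2:
  assumes "odd CARD('n::finite)"
  shows "\<not> (\<exists>f :: complex ^ 'n \<Rightarrow> complex ^ 'n.
            continuous_on (carrier torus_group) f \<and> inverse_ambiguous torus_group f)"
proof
  assume "\<exists>f :: complex ^ 'n \<Rightarrow> complex ^ 'n.
            continuous_on (carrier torus_group) f \<and> inverse_ambiguous torus_group f"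
  then obtain f :: "complex ^ 'n \<Rightarrow> complex ^ 'n"
    where contf: "continuous_on (carrier torus_group) f"
      and amb: "inverse_ambiguous torus_group f"
    by blast
  have "continuous_on UNIV (\<lambda>t. f (torus_exp t))"
    using contf continuous_on_torus_exp
    by (rule continuous_on_compose2) (auto simp: torus_exp_in_torus)
  moreover have "range (\<lambda>t. f (torus_exp t)) \<subseteq> carrier torus_group"
    using inverse_ambiguous_closed[OF amb] torus_exp_in_torus by blast
  ultimately obtain g :: "real ^ 'n \<Rightarrow> real ^ 'n"
    where contg: "continuous_on UNIV g" and g: "\<And>t. f (torus_exp t) = torus_exp (g t)"
    using torus_map_lift[of UNIV "\<lambda>t. f (torus_exp t)"] by (auto simp: convex_imp_contractible)
  have contg': "continuous_on S (\<lambda>t. g (h t))" if "continuous_on S h" for S and h :: "real ^ 'n \<Rightarrow> real ^ 'n"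
    using continuous_on_compose2[OF contg that] by simp

  define D where "D m = g m - g 0" for m
  have shift_in: "g (t + m) - g t \<in> int_lattice" if "m \<in> int_lattice" for t m
  proof -
    have "torus_exp (t + m) = torus_exp t"
      using that by (simp add: torus_exp_eq_iff)
    then show ?thesis
      by (metis g torus_exp_eq_iff)
  qed
  \<comment> \<open>For fixed \<open>m\<close> the increment is continuous in \<open>t\<close> with
    lattice values, so it agrees with its value \<open>D m\<close> at \<open>t = 0\<close>.\<close>
  have shift: "g (t + m) = g t + D m" if "m \<in> int_lattice" for t m
  proof -
    have "g (t + m) - g t = g (0 + m) - g 0"
      by (rule continuous_int_lattice_constant[where S = UNIV and h = "\<lambda>t. g (t + m) - g t"])
         (use shift_in[OF that] in \<open>auto intro!: continuous_intros contg'\<close>)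
    then show ?thesis
      by (simp add: D_def algebra_simps)
  qed
  have D_in: "D m \<in> int_lattice" if "m \<in> int_lattice" for m
    using shift_in[OF that, of 0] by (simp add: D_def)
  have D_matrix: "D m = matrix D *v m" if "m \<in> int_lattice" for m
  proof (rule additive_on_int_lattice_matrix[OF _ that])
    fix m m' :: "real ^ 'n" assume "m \<in> int_lattice" "m' \<in> int_lattice"
    then show "D (m + m') = D m + D m'"
      \<comment> \<open>Base point \<open>m\<close>: \<open>g (m + m') = g m + D m'\<close>.\<close>
      using shift[of m' m] by (simp add: D_def)
  qed

  have gg_in: "g (g t) + t \<in> int_lattice" for t
  proof -
    interpret group "torus_group :: (complex ^ 'n) monoid"
      by (rule group_torus_group)
    have "torus_exp (g (g t)) \<otimes>\<^bsub>torus_group\<^esub> torus_exp t = \<one>\<^bsub>torus_group\<^esub>"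
      using inverse_ambiguous_mult[OF amb torus_exp_in_torus] by (simp add: g)
    \<comment> \<open>\<open>torus_exp\<close> turns sums into products, and the unit is
      \<open>torus_exp 0\<close>.\<close>
    then have "torus_exp (g (g t) + t) = torus_exp 0"
      by (simp add: torus_group_def circle_group_def torus_exp_def vec_eq_iff cis_mult
          distrib_left)
    then show ?thesis
      by (simp add: torus_exp_eq_iff)
  qed
  have DD: "D (D m) = - m" if "m \<in> int_lattice" for m
  proof -
    have "g (g m) + m = g (g 0) + 0"
      by (rule continuous_int_lattice_constant[where S = UNIV and h = "\<lambda>t. g (g t) + t"])
         (use gg_in in \<open>auto intro!: continuous_intros contg' contg\<close>)
    \<comment> \<open>Shift twice: \<open>g m = g 0 + D m\<close>, and \<open>D m\<close> is again a
      lattice vector, now added at the base point \<open>g 0\<close>.\<close>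
    moreover have "g (g m) = g (g 0) + D (D m)"
      using shift[OF that, of 0] shift[OF D_in[OF that], of "g 0"] by simp
    ultimately show ?thesis
      by (simp add: eq_neg_iff_add_eq_0)
  qed

  \<comment> \<open>Both matrices are compared column by column. The difference rule with first
    matrix 0 evaluates \<open>- mat 1\<close> at a unit vector.\<close>
  have "(matrix D ** matrix D) *v axis j 1 = (- mat 1) *v axis j 1" for j
    using DD[OF axis_in_int_lattice[of j]]
      D_matrix[OF axis_in_int_lattice[of j]] D_matrix[OF D_in[OF axis_in_int_lattice[of j]]]
      matrix_vector_mult_diff_rdistrib[of 0 "mat 1" "axis j 1 :: real ^ 'n"]
    by (simp add: matrix_vector_mul_assoc)
  then have "column j (matrix D ** matrix D) = column j (- mat 1)" for j
    by (simp only: matrix_vector_mult_basis)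
  then have "matrix D ** matrix D = - mat 1"
    by (simp add: vec_eq_iff column_def)
  then show False
    using square_eq_neg_one_imp_even assms by blast
qed

end
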